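(* Let $A$ and $B$ be quasi-normal subgroups of a group $G$. Then $A\cap B$ is quasi-normal in $G$.
   Context: For a subgroup $H$ of a group $G$, the commensurator of $H$ in $G$ is $Comm(H,G)=\{g\in G : gHg^{-1}\cap H \text{ has finite index in both } H \text{ and } gHg^{-1}\}$. A subgroup $Q$ of $G$ is quasi-normal in $G$ if $Comm(Q,G)=G$. *)

theory Defs
  imports "HOL-Algebra.Coset"
begin

text \<open>
  Finiteness of the set of right cosets of \<open>K\<close> in \<open>H\<close>; this is the finiteness of the index
  \<open>[H : K]\<close> when \<open>K\<close> is a subgroup of \<open>H\<close>, which is the only case in which it is used.
  Finiteness of the set itself is required, rather than a condition on its \<open>card\<close>, because
  the latter is \<open>0\<close> for infinite sets.
\<close>

definition finite_index :: "('a, 'b) monoid_scheme \<Rightarrow> 'a set \<Rightarrow> 'a set \<Rightarrow> bool" where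
  "finite_index G K H \<longleftrightarrow> finite (rcosets\<^bsub>G\<lparr>carrier := H\<rparr>\<^esub> K)"

definition conjugate_set :: "('a, 'b) monoid_scheme \<Rightarrow> 'a \<Rightarrow> 'a set \<Rightarrow> 'a set" where
  "conjugate_set G g H = g <#\<^bsub>G\<^esub> H #>\<^bsub>G\<^esub> (inv\<^bsub>G\<^esub> g)"

definition commensurator :: "'a set \<Rightarrow> ('a, 'b) monoid_scheme \<Rightarrow> 'a set" where
  "commensurator H G =
     {g \<in> carrier G.
        finite_index G (conjugate_set G g H \<inter> H) H \<and>
        finite_index G (conjugate_set G g H \<inter> H) (conjugate_set G g H)}"

definition quasi_normal :: "'a set \<Rightarrow> ('a, 'b) monoid_scheme \<Rightarrow> bool" where
  "quasi_normal Q G \<longleftrightarrow> subgroup Q G \<and> commensurator Q G = carrier G"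

end

theory Submission
  imports Defs
begin

text \<open>Translations in a group are injective, so they commute with intersections. Hence
  conjugation by \<open>g\<close> does too (\<open>conjugate_set_Int\<close>), and a coset of an
  intersection is determined by a pair of cosets. So if K has finite index in H and L in M, then K
  \<inter> L has finite index in H \<inter> M (\<open>finite_index_Int\<close>). Apply this to
  gAg^-1 \<inter> A and gBg^-1 \<inter> B, once inside A and B and once inside their
  conjugates.\<close>

lemma (in group) r_coset_Int:
  assumes "H \<subseteq> carrier G" "K \<subseteq> carrier G" "x \<in> carrier G"
  shows "(H \<inter> K) #> x = (H #> x) \<inter> (K #> x)"
  using assms by (fastforce simp: r_coset_def dest: subsetD)

lemma (in group) l_coset_Int:
  assumes "H \<subseteq> carrier G" "K \<subseteq> carrier G" "x \<in> carrier G"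
  shows "x <# (H \<inter> K) = (x <# H) \<inter> (x <# K)"
  using assms by (fastforce simp: l_coset_def dest: subsetD)

lemma (in group) conjugate_set_Int:
  assumes "H \<subseteq> carrier G" "K \<subseteq> carrier G" "g \<in> carrier G"
  shows "conjugate_set G g (H \<inter> K) = conjugate_set G g H \<inter> conjugate_set G g K"
  using assms by (simp add: conjugate_set_def l_coset_Int r_coset_Int l_coset_subset_G)

lemma (in group) conjugate_set_closed:
  assumes "H \<subseteq> carrier G" "g \<in> carrier G"
  shows "conjugate_set G g H \<subseteq> carrier G"
  using assms by (simp add: conjugate_set_def l_coset_subset_G r_coset_subset_G)

text \<open>Replacing the carrier by \<open>H\<close> leaves the multiplication alone and only
  restricts the representatives, so index bounds become statements about images in
  \<open>G\<close>.\<close>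

lemma finite_index_iff: "finite_index G K H \<longleftrightarrow> finite ((\<lambda>h. K #>\<^bsub>G\<^esub> h) ` H)"
  by (simp add: finite_index_def RCOSETS_def r_coset_def UNION_singleton_eq_range)

text \<open>A coset of \<open>K \<inter> L\<close> is the intersection of a coset of \<open>K\<close> and one of \<open>L\<close>.\<close>

lemma (in group) finite_index_Int:
  assumes "finite_index G K H" "finite_index G L M"
    and "K \<subseteq> carrier G" "L \<subseteq> carrier G" "H \<subseteq> carrier G"
  shows "finite_index G (K \<inter> L) (H \<inter> M)"
proof -
  \<comment> \<open>The same \<open>h\<close> represents both cosets, since it lies in
    \<open>H\<close> and in \<open>M\<close>; the pairs range over a finite product.\<close>
  have "(\<lambda>h. (K \<inter> L) #> h) ` (H \<inter> M)
      \<subseteq> (\<lambda>(U, V). U \<inter> V) ` ((\<lambda>h. K #> h) ` H \<times> (\<lambda>h. L #> h) ` M)"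
    using assms(3-5) by (force simp: r_coset_Int)
  with assms(1,2) show ?thesis
    unfolding finite_index_iff by (meson finite_SigmaI finite_imageI finite_subset)
qed

theorem proposition9:
  fixes G :: "('a, 'b) monoid_scheme" and A B :: "'a set"
  assumes "group G"
    and "quasi_normal A G"
    and "quasi_normal B G"
  shows "quasi_normal (A \<inter> B) G"
proof -
  interpret group G by fact
  have sub: "subgroup A G" "subgroup B G"
    using assms(2,3) by (simp_all add: quasi_normal_def)
  then have AB: "A \<subseteq> carrier G" "B \<subseteq> carrier G"
    by (simp_all add: subgroup.subset)
  have "g \<in> commensurator (A \<inter> B) G" if g: "g \<in> carrier G" for g
  proof -
    let ?X = "conjugate_set G g A" and ?Y = "conjugate_set G g B"
    have "g \<in> commensurator A G" "g \<in> commensurator B G"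
      using assms(2,3) g by (simp_all add: quasi_normal_def)
    then have fin: "finite_index G (?X \<inter> A) A" "finite_index G (?X \<inter> A) ?X"
      "finite_index G (?Y \<inter> B) B" "finite_index G (?Y \<inter> B) ?Y"
      by (simp_all add: commensurator_def)
    have closed: "?X \<subseteq> carrier G" "?X \<inter> A \<subseteq> carrier G" "?Y \<inter> B \<subseteq> carrier G"
      using AB g conjugate_set_closed by blast+
    \<comment> \<open>Regrouped by subgroup, the intersection has the shape that
      \<open>finite_index_Int\<close> handles.\<close>
    have "?X \<inter> ?Y \<inter> (A \<inter> B) = (?X \<inter> A) \<inter> (?Y \<inter> B)"
      by blast
    then show ?thesis
      \<comment> \<open>The first instance bounds the index in \<open>A \<inter> B\<close>, the
        second that in its conjugate \<open>?X \<inter> ?Y\<close>.\<close>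
      using finite_index_Int[OF fin(1,3) closed(2,3) AB(1)]
        finite_index_Int[OF fin(2,4) closed(2,3,1)] g
      by (simp add: commensurator_def conjugate_set_Int[OF AB g])
  qed
  then show ?thesis
    using subgroups_Inter_pair[OF sub] by (auto simp: quasi_normal_def commensurator_def)
qed

end
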